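(* Let $E=(e_{ij})$ be an $n\times n$ real matrix with $e_{ii}=0$ for $i=1,\dots,n$ and $e_{ij}\geqslant 0$ for every pair $i\neq j$, $i,j\in\{1,\dots,n\}$. If the spectral radius $r(E)$ equals $1$, then there exist a Banach space $X$, complemented subspaces $X_1,\dots,X_n$ of $X$ and (continuous linear) projections $P_1,\dots,P_n$ onto $X_1,\dots,X_n$, respectively, such that (1) $\|P_i x\|=e_{ij}\|x\|$ for all $x\in X_j$, for each pair $i\neq j$, $i,j\in\{1,\dots,n\}$; (2) $X_1,\dots,X_n$ are linearly independent; (3) $X_1+\dots+X_n$ is closed and not complemented in $X$.
   Context: Banach spaces are real or complex. A subspace means a linear subset. A subspace $M$ of $X$ is complemented in $X$ if there is a subspace $N$ such that $X$ is the topological direct sum of $M$ and $N$; equivalently, there is a continuous linear projection of $X$ onto $M$. The sum is $X_1+\dots+X_n=\{x_1+\dots+x_n\mid x_i\in X_i\}$. Subspaces $X_1,\dots,X_n$ are linearly independent if $x_1+\dots+x_n=0$ with $x_i\in X_i$ implies $x_1=\dots=x_n=0$. *)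

theory Defs
  imports
    "HOL-Analysis.Analysis"
    "HOL-Library.Function_Algebras"
    "Jordan_Normal_Form.Spectral_Radius"
begin

text \<open>
  A Banach space is given by a carrier: a linear subset \<open>V\<close> of an ambient vector space, with a
  complete norm on \<open>V\<close>. The norm is arbitrary, unrelated to any norm or topology of the ambient
  type, and its values outside \<open>V\<close> are irrelevant. The scalar field \<open>'k\<close> stands for the reals or
  the complex numbers: both are instances of the two classes and, by the Gelfand-Mazur theorem,
  they are the only ones up to isomorphism.

  Since \<open>Metric_space\<close> demands nonnegativity and symmetry on the whole type, the distance is set
  to 0 off the carrier.
\<close>

definition norm_dist :: "'v::ab_group_add set \<Rightarrow> ('v \<Rightarrow> real) \<Rightarrow> 'v \<Rightarrow> 'v \<Rightarrow> real" where
  "norm_dist V nrm x y = (if x \<in> V \<and> y \<in> V then nrm (x - y) else 0)"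

locale banach_space_on = vector_space scale
  for scale :: "'k::{real_normed_field, banach} \<Rightarrow> 'v::ab_group_add \<Rightarrow> 'v" +
  fixes V :: "'v set" and nrm :: "'v \<Rightarrow> real"
  assumes subspace_carrier: "subspace V"
    and nrm_eq_0_iff: "x \<in> V \<Longrightarrow> nrm x = 0 \<longleftrightarrow> x = 0"
    and nrm_scale: "x \<in> V \<Longrightarrow> nrm (scale c x) = norm c * nrm x"
    and nrm_triangle: "x \<in> V \<Longrightarrow> y \<in> V \<Longrightarrow> nrm (x + y) \<le> nrm x + nrm y"
    and complete_carrier: "Metric_space.mcomplete V (norm_dist V nrm)"
begin

lemma nrm_minus: "x \<in> V \<Longrightarrow> nrm (- x) = nrm x"
  using nrm_scale[of x "- 1"] by simp

lemma nrm_nonneg: 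
  assumes "x \<in> V" 
  shows "0 \<le> nrm x"
proof -
  have "- x \<in> V" "0 \<in> V"
    using assms subspace_carrier by (auto intro: subspace_neg subspace_0)
  then show ?thesis
    using nrm_triangle[of x "- x"] nrm_minus[of x] nrm_eq_0_iff[of 0] assms by simp
qed

sublocale Metric_space V "norm_dist V nrm"
proof
  note diff = subspace_diff[OF subspace_carrier]
  show "0 \<le> norm_dist V nrm x y" for x y
    by (auto simp: norm_dist_def intro: nrm_nonneg diff)
  show "norm_dist V nrm x y = norm_dist V nrm y x" for x y
    using nrm_minus[of "x - y"] diff[of x y] by (auto simp: norm_dist_def)
  show "norm_dist V nrm x y = 0 \<longleftrightarrow> x = y" if "x \<in> V" "y \<in> V" for x y
    using that nrm_eq_0_iff[of "x - y"] diff[of x y] by (simp add: norm_dist_def)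
  show "norm_dist V nrm x z \<le> norm_dist V nrm x y + norm_dist V nrm y z"
    if "x \<in> V" "y \<in> V" "z \<in> V" for x y z
    using that nrm_triangle[of "x - y" "y - z"] diff[of x y] diff[of y z]
    by (simp add: norm_dist_def)
qed

text \<open>The homeomorphism condition includes bijectivity of the addition map \<open>M \<times> N \<rightarrow> V\<close>,
  that is, the algebraic direct sum decomposition.\<close>

definition topological_direct_sum :: "'v set \<Rightarrow> 'v set \<Rightarrow> bool" where
  "topological_direct_sum M N \<longleftrightarrow>
     M \<subseteq> V \<and> subspace M \<and> N \<subseteq> V \<and> subspace N \<and>
     homeomorphic_map (prod_topology (subtopology mtopology M) (subtopology mtopology N))
       mtopology (\<lambda>(x, y). x + y)"

definition complemented :: "'v set \<Rightarrow> bool" where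
  "complemented M \<longleftrightarrow> (\<exists>N. topological_direct_sum M N)"

definition continuous_projection_onto :: "('v \<Rightarrow> 'v) \<Rightarrow> 'v set \<Rightarrow> bool" where
  "continuous_projection_onto P M \<longleftrightarrow>
     continuous_map mtopology mtopology P \<and>
     (\<forall>x\<in>V. \<forall>y\<in>V. P (x + y) = P x + P y) \<and>
     (\<forall>c. \<forall>x\<in>V. P (scale c x) = scale c (P x)) \<and>
     (\<forall>x\<in>V. P (P x) = P x) \<and>
     P ` V = M"

end

text \<open>Families of subspaces are indexed by \<open>{..<n}\<close> instead of \<open>{1..n}\<close>, in accordance with the
  row and column indices of matrices.\<close>

definition subspace_sum :: "nat \<Rightarrow> (nat \<Rightarrow> 'v::ab_group_add set) \<Rightarrow> 'v set" where
  "subspace_sum n S = {\<Sum>i<n. x i | x. \<forall>i<n. x i \<in> S i}"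

definition subspaces_independent :: "nat \<Rightarrow> (nat \<Rightarrow> 'v::ab_group_add set) \<Rightarrow> bool" where
  "subspaces_independent n S \<longleftrightarrow>
     (\<forall>x. (\<forall>i<n. x i \<in> S i) \<and> (\<Sum>i<n. x i) = 0 \<longrightarrow> (\<forall>i<n. x i = 0))"

text \<open>The vector space of all scalar sequences; addition is the pointwise one.\<close>

definition seq_scale :: "'k::field \<Rightarrow> (nat \<Rightarrow> 'k) \<Rightarrow> (nat \<Rightarrow> 'k)" where
  "seq_scale c x = (\<lambda>m. c * x m)"

end

theory Submission
  imports Defs
begin

text \<open>
  The construction transports the fact that \<open>c\<^sub>0\<close> is not complemented in \<open>\<ell>\<^sup>\<infinity>\<close>. As the entries of \<open>E\<close>
  are nonnegative and its spectral radius is 1, there is a real vector \<open>w \<noteq> 0\<close> with \<open>E w = w\<close>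
  (\<open>real_eigenvector_normalized\<close>). Inside the \<open>n\<close>-th power of \<open>\<ell>\<^sup>\<infinity>\<close>, with the supremum norm, take
  \<open>X = c\<^sub>0\<^sup>n + w \<otimes> \<ell>\<^sup>\<infinity>\<close>, let \<open>X\<^sub>i\<close> be the copy of \<open>c\<^sub>0\<close> in component \<open>i\<close>, and let \<open>P\<^sub>i\<close> send \<open>u\<close> to the
  component \<open>i\<close> of \<open>(1 - E) u\<close>.

  The operator \<open>1 - E\<close> kills \<open>w \<otimes> \<ell>\<^sup>\<infinity>\<close>, so \<open>P\<^sub>i\<close> does map \<open>X\<close> into \<open>c\<^sub>0\<close>; it is the identity on \<open>X\<^sub>i\<close>
  because the diagonal of \<open>E\<close> is 0, and on \<open>X\<^sub>j\<close>, \<open>j \<noteq> i\<close>, it is \<open>- e\<^sub>i\<^sub>j\<close> times the obvious isometry onto \<open>X\<^sub>i\<close>. The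
  sum of the \<open>X\<^sub>i\<close> is the closed subspace \<open>c\<^sub>0\<^sup>n\<close>. It is not complemented in \<open>X\<close>: the copy \<open>w \<otimes> \<ell>\<^sup>\<infinity>\<close> of
  \<open>\<ell>\<^sup>\<infinity>\<close> meets it in \<open>w \<otimes> c\<^sub>0\<close>, so a projection onto it would induce one of \<open>\<ell>\<^sup>\<infinity>\<close> onto \<open>c\<^sub>0\<close>, contrary to
  \<open>no_bounded_projection_onto_null_seqs\<close>.

  As \<open>n\<close> sequences can be interleaved into one, \<open>X\<close> is realized as a space of scalar sequences.
\<close>

section \<open>The eigenvalue 1 of a nonnegative matrix of spectral radius 1\<close>

unbundle no vec_syntax

lemma mult_mat_vec_index_sum:
  assumes "A \<in> carrier_mat n n" "v \<in> carrier_vec n" "i < n"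
  shows "(A *\<^sub>v v) $ i = (\<Sum>j<n. A $$ (i, j) * v $ j)"
  using assms by (simp add: scalar_prod_def atLeast0LessThan)

lemma pow_mat_commute:
  assumes A: "(A :: 'a::semiring_1 mat) \<in> carrier_mat n n"
  shows "A ^\<^sub>m k * A = A * A ^\<^sub>m k"
proof (induction k)
  case 0
  then show ?case using A by simp
next
  case (Suc k)
  then show ?case using A assoc_mult_mat[OF A pow_carrier_mat[OF A] A] by simp
qed

lemma scaled_shift_mult_mat_vec:
  fixes A :: "'a::comm_ring_1 mat"
  assumes "A \<in> carrier_mat n n" "v \<in> carrier_vec n"
  shows "(c \<cdot>\<^sub>m (1\<^sub>m n + A)) *\<^sub>v v = c \<cdot>\<^sub>v (v + A *\<^sub>v v)"
proof -
  have "(1\<^sub>m n + A) *\<^sub>v v = v + A *\<^sub>v v"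
    using assms by (simp add: add_mult_distrib_mat_vec[of _ n n])
  moreover have "(c \<cdot>\<^sub>m (1\<^sub>m n + A)) *\<^sub>v v = c \<cdot>\<^sub>v ((1\<^sub>m n + A) *\<^sub>v v)"
    using assms by (intro eq_vecI) auto
  ultimately show ?thesis by simp
qed

lemma pow_mat_mult_vec_ge:
  fixes G :: "real mat"
  assumes G: "G \<in> carrier_mat n n" and nonneg: "\<And>i j. i < n \<Longrightarrow> j < n \<Longrightarrow> 0 \<le> G $$ (i, j)"
    and x: "x \<in> carrier_vec n" and b: "0 \<le> b"
    and super: "\<And>i. i < n \<Longrightarrow> b * x $ i \<le> (G *\<^sub>v x) $ i"
  shows "i < n \<Longrightarrow> b ^ k * x $ i \<le> (G ^\<^sub>m k *\<^sub>v x) $ i"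
proof (induction k arbitrary: i)
  case 0
  then show ?case using G x by simp
next
  case (Suc k)
  have y: "G ^\<^sub>m k *\<^sub>v x \<in> carrier_vec n"
    using G x by (metis mult_mat_vec_carrier pow_carrier_mat)
  have step: "G ^\<^sub>m Suc k *\<^sub>v x = G *\<^sub>v (G ^\<^sub>m k *\<^sub>v x)"
    using G x by (simp add: pow_mat_commute[OF G] assoc_mult_mat_vec[OF G pow_carrier_mat[OF G] x])
  have "b ^ Suc k * x $ i = b ^ k * (b * x $ i)" by simp
  also have "\<dots> \<le> b ^ k * (G *\<^sub>v x) $ i"
    using super[OF Suc.prems] b by (intro mult_left_mono) auto
  also have "\<dots> = (\<Sum>j<n. G $$ (i, j) * (b ^ k * x $ j))"
    unfolding mult_mat_vec_index_sum[OF G x Suc.prems] by (simp add: sum_distrib_left algebra_simps)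
  also have "\<dots> \<le> (\<Sum>j<n. G $$ (i, j) * (G ^\<^sub>m k *\<^sub>v x) $ j)"
    using Suc nonneg by (intro sum_mono mult_left_mono) auto
  also have "\<dots> = (G ^\<^sub>m Suc k *\<^sub>v x) $ i"
    unfolding step mult_mat_vec_index_sum[OF G y Suc.prems] ..
  finally show ?case .
qed

text \<open>Iterating \<open>G x \<ge> b x\<close> gives \<open>G^k x \<ge> b^k x\<close>. As \<open>b > 1\<close> and \<open>x\<close> has a positive entry,
  the powers of \<open>G\<close> are unbounded, whereas the powers of a matrix of spectral radius below 1 are bounded.\<close>

lemma spectral_radius_ge_supersolution:
  fixes G :: "real mat"
  assumes G: "G \<in> carrier_mat n n" and nonneg: "\<And>i j. i < n \<Longrightarrow> j < n \<Longrightarrow> 0 \<le> G $$ (i, j)"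
    and x: "x \<in> carrier_vec n" and x_nonneg: "\<And>i. i < n \<Longrightarrow> 0 \<le> x $ i"
    and m: "m < n" "0 < x $ m" and b: "1 < b"
    and super: "\<And>i. i < n \<Longrightarrow> b * x $ i \<le> (G *\<^sub>v x) $ i"
  shows "1 \<le> spectral_radius (map_mat complex_of_real G)"
proof (rule ccontr)
  assume "\<not> ?thesis"
  then obtain C where C: "\<And>k. norm_bound (map_mat complex_of_real G ^\<^sub>m k) C"
    using spectral_radius_jnf_norm_bound_less_1_upper_triangular[of "map_mat complex_of_real G" n] G
    by auto
  have bound: "\<bar>(G ^\<^sub>m k) $$ (i, j)\<bar> \<le> C" if "i < n" "j < n" for i j k
  proof -
    have eq: "map_mat complex_of_real G ^\<^sub>m k = map_mat complex_of_real (G ^\<^sub>m k)"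
      using of_real_hom.mat_hom_pow[OF G] by metis
    have "dim_row (G ^\<^sub>m k) = n" "dim_col (G ^\<^sub>m k) = n"
      using carrier_matD[OF pow_carrier_mat[OF G]] by blast+
    then show ?thesis using C[of k] that unfolding eq norm_bound_def by (simp del: pow_mat_dim)
  qed
  have upper: "b ^ k * x $ m \<le> C * (\<Sum>j<n. x $ j)" for k
  proof -
    have "b ^ k * x $ m \<le> (G ^\<^sub>m k *\<^sub>v x) $ m"
      using pow_mat_mult_vec_ge[OF G nonneg x _ super] m b by auto
    also have "\<dots> = (\<Sum>j<n. (G ^\<^sub>m k) $$ (m, j) * x $ j)"
      using mult_mat_vec_index_sum[of "G ^\<^sub>m k" n x m] G x m by simp
    also have "\<dots> \<le> (\<Sum>j<n. C * x $ j)"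
      using bound[OF m(1)] x_nonneg by (intro sum_mono mult_right_mono) (auto simp: abs_le_iff)
    finally show ?thesis by (simp add: sum_distrib_left)
  qed
  obtain k where "C * (\<Sum>j<n. x $ j) / x $ m < b ^ k"
    using real_arch_pow[OF b] by blast
  with upper[of k] m show False by (simp add: divide_simps mult.commute)
qed

lemma eigenvalue_shift_scale:
  fixes A :: "'a::field mat"
  assumes A: "A \<in> carrier_mat n n" and c: "c \<noteq> 0" and ev: "eigenvalue (c \<cdot>\<^sub>m (1\<^sub>m n + A)) \<kappa>"
  shows "eigenvalue A (\<kappa> / c - 1)"
proof -
  obtain v where v: "v \<in> carrier_vec n" "v \<noteq> 0\<^sub>v n" and eq: "(c \<cdot>\<^sub>m (1\<^sub>m n + A)) *\<^sub>v v = \<kappa> \<cdot>\<^sub>v v"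
    using ev A unfolding eigenvalue_def eigenvector_def by auto
  have "(A *\<^sub>v v) $ i = (\<kappa> / c - 1) * v $ i" if i: "i < n" for i
  proof -
    have "\<kappa> * v $ i = ((c \<cdot>\<^sub>m (1\<^sub>m n + A)) *\<^sub>v v) $ i" using eq v i by simp
    also have "(c \<cdot>\<^sub>m (1\<^sub>m n + A)) *\<^sub>v v = c \<cdot>\<^sub>v (v + A *\<^sub>v v)"
      using A v(1) by (rule scaled_shift_mult_mat_vec)
    finally have "\<kappa> * v $ i = c * (v $ i + (A *\<^sub>v v) $ i)"
      using A v i by simp
    with c show ?thesis by (simp add: field_simps)
  qed
  then have "A *\<^sub>v v = (\<kappa> / c - 1) \<cdot>\<^sub>v v"
    using A v by (intro eq_vecI) auto
  then show ?thesis using A v unfolding eigenvalue_def eigenvector_def by auto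
qed

text \<open>On the closed unit disc, \<open>1\<close> is the only point at which \<open>\<bar>1 + z\<bar>\<close> attains 2. This is
  what makes the shift by the identity matrix separate the eigenvalue 1 from the other eigenvalues of
  modulus 1.\<close>

lemma norm_one_plus_less_2:
  fixes z :: complex
  assumes "norm z \<le> 1" "z \<noteq> 1"
  shows "norm (1 + z) < 2"
proof (rule ccontr)
  assume "\<not> ?thesis"
  then have "4 \<le> (norm (1 + z))\<^sup>2"
    using power_mono[of 2 "norm (1 + z)" 2] by simp
  moreover have "(norm z)\<^sup>2 \<le> 1" using assms(1) by (simp add: power_le_one)
  ultimately have *: "(1 + Re z)\<^sup>2 + (Im z)\<^sup>2 \<ge> 4" "(Re z)\<^sup>2 + (Im z)\<^sup>2 \<le> 1"
    by (simp_all add: cmod_power2)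
  then have "1 \<le> Re z" by (simp add: power2_eq_square algebra_simps)
  then have "1 \<le> (Re z)\<^sup>2" by (simp add: power2_eq_square mult_ge1_I)
  then have "(Im z)\<^sup>2 = 0" "(Re z)\<^sup>2 \<le> 1" using * zero_le_power2[of "Im z"] by linarith+
  then have "Im z = 0" "Re z = 1" using \<open>1 \<le> Re z\<close> by (auto simp: abs_square_le_1)
  then show False using assms(2) by (simp add: complex_eq_iff)
qed

text \<open>The weak Perron-Frobenius theorem. If 1 were not an eigenvalue, every eigenvalue of
  \<open>1 + E\<close> would have modulus less than some \<open>s < 2\<close>, so \<open>(1 + E) / s\<close> would have spectral radius
  below 1. But for an eigenvector \<open>v\<close> whose eigenvalue has modulus 1 the vector \<open>x\<close> of the moduli of
  its entries satisfies \<open>E x \<ge> x\<close> by the triangle inequality, hence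
  \<open>((1 + E) / s) x \<ge> (2 / s) x\<close> with \<open>2 / s > 1\<close>.\<close>

lemma spectral_radius_one_eigenvalue:
  fixes E :: "real mat"
  assumes n: "0 < n" and E: "E \<in> carrier_mat n n"
    and nonneg: "\<And>i j. i < n \<Longrightarrow> j < n \<Longrightarrow> 0 \<le> E $$ (i, j)"
    and rad: "spectral_radius (map_mat complex_of_real E) = 1"
  shows "eigenvalue (map_mat complex_of_real E) 1"
proof (rule ccontr)
  let ?Ec = "map_mat complex_of_real E"
  assume no: "\<not> eigenvalue ?Ec 1"
  have Ec: "?Ec \<in> carrier_mat n n" using E by simp
  obtain l v where l: "norm l = 1" and v: "v \<in> carrier_vec n" "v \<noteq> 0\<^sub>v n" "?Ec *\<^sub>v v = l \<cdot>\<^sub>v v"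
    using spectral_radius_mem_max(1)[OF Ec n] E unfolding rad spectrum_def eigenvalue_def eigenvector_def
    by auto
  define x where "x = vec n (\<lambda>i. norm (v $ i))"
  have x: "x \<in> carrier_vec n" by (simp add: x_def)
  have Ex: "x $ i \<le> (\<Sum>j<n. E $$ (i, j) * x $ j)" if i: "i < n" for i
  proof -
    have "x $ i = norm ((?Ec *\<^sub>v v) $ i)"
      using v i l by (simp add: x_def norm_mult)
    also have "\<dots> = norm (\<Sum>j<n. complex_of_real (E $$ (i, j)) * v $ j)"
      using mult_mat_vec_index_sum[OF Ec v(1) i] E i by simp
    also have "\<dots> \<le> (\<Sum>j<n. norm (complex_of_real (E $$ (i, j)) * v $ j))" by (rule norm_sum)
    also have "\<dots> = (\<Sum>j<n. E $$ (i, j) * x $ j)"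
      using nonneg i by (intro sum.cong) (auto simp: x_def norm_mult)
    finally show ?thesis .
  qed
  obtain m where m: "m < n" "0 < x $ m"
  proof -
    have "\<exists>m<n. v $ m \<noteq> 0" using v by (auto intro!: eq_vecI)
    then show ?thesis using that by (auto simp: x_def)
  qed
  have spec: "norm (1 + \<mu>) < 2" if "eigenvalue ?Ec \<mu>" for \<mu>
    using that no spectral_radius_mem_max(2)[OF Ec n, of "norm \<mu>"] rad
    by (intro norm_one_plus_less_2) (auto simp: spectrum_def)
  define \<rho> where "\<rho> = Max ((\<lambda>\<mu>. norm (1 + \<mu>)) ` spectrum ?Ec)"
  have fin: "finite (spectrum ?Ec)" and ne: "spectrum ?Ec \<noteq> {}"
    using card_finite_spectrum(1)[OF Ec] spectrum_non_empty[OF Ec n] by auto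
  have \<rho>: "\<rho> < 2" and \<rho>_ge: "\<And>\<mu>. eigenvalue ?Ec \<mu> \<Longrightarrow> norm (1 + \<mu>) \<le> \<rho>"
    using fin ne spec by (auto simp: \<rho>_def spectrum_def)
  obtain \<mu> where "eigenvalue ?Ec \<mu>" using ne by (auto simp: spectrum_def)
  with \<rho>_ge have "0 \<le> \<rho>" by (meson norm_ge_zero order_trans)
  obtain s where s: "\<rho> < s" "s < 2" using \<rho> dense by blast
  have "0 < s" using s \<open>0 \<le> \<rho>\<close> by simp
  define G where "G = (1 / s) \<cdot>\<^sub>m (1\<^sub>m n + E)"
  have G: "G \<in> carrier_mat n n" using E by (simp add: G_def)
  have Gc: "map_mat complex_of_real G = complex_of_real (1 / s) \<cdot>\<^sub>m (1\<^sub>m n + ?Ec)"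
    using E by (intro eq_matI) (auto simp: G_def)
  have "1 \<le> spectral_radius (map_mat complex_of_real G)"
  proof (rule spectral_radius_ge_supersolution[OF G _ x _ m, of "2 / s"])
    show "0 \<le> G $$ (i, j)" if "i < n" "j < n" for i j
      using that E nonneg \<open>0 < s\<close> by (auto simp: G_def)
    show "2 / s * x $ i \<le> (G *\<^sub>v x) $ i" if i: "i < n" for i
    proof -
      have "G *\<^sub>v x = (1 / s) \<cdot>\<^sub>v (x + E *\<^sub>v x)"
        unfolding G_def using E x by (rule scaled_shift_mult_mat_vec)
      then have "(G *\<^sub>v x) $ i = 1 / s * (x $ i + (\<Sum>j<n. E $$ (i, j) * x $ j))"
        using E x i mult_mat_vec_index_sum[OF E x i] by simp
      moreover have "1 / s * (2 * x $ i) \<le> 1 / s * (x $ i + (\<Sum>j<n. E $$ (i, j) * x $ j))"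
        using Ex[OF i] \<open>0 < s\<close> by (intro mult_left_mono) auto
      ultimately show ?thesis by simp
    qed
  qed (use s \<open>0 < s\<close> in \<open>auto simp: x_def\<close>)
  moreover have "spectral_radius (map_mat complex_of_real G) < 1"
  proof -
    have "map_mat complex_of_real G \<in> carrier_mat n n" using G by simp
    from spectral_radius_mem_max(1)[OF this n] obtain \<kappa>
      where "eigenvalue (map_mat complex_of_real G) \<kappa>"
        and r: "spectral_radius (map_mat complex_of_real G) = norm \<kappa>"
      by (auto simp: spectrum_def)
    then have "eigenvalue ?Ec (\<kappa> / complex_of_real (1 / s) - 1)"
      unfolding Gc using \<open>0 < s\<close> by (intro eigenvalue_shift_scale[OF Ec]) auto
    from \<rho>_ge[OF this] have "norm \<kappa> * s \<le> \<rho>" using \<open>0 < s\<close> by (simp add: norm_mult)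
    then have "norm \<kappa> * s < s" using s by simp
    then show ?thesis using r \<open>0 < s\<close> by simp
  qed
  ultimately show False by simp
qed

lemma real_eigenvector_normalized:
  fixes E :: "real mat"
  assumes n: "0 < n" and E: "E \<in> carrier_mat n n"
    and nonneg: "\<And>i j. i < n \<Longrightarrow> j < n \<Longrightarrow> 0 \<le> E $$ (i, j)"
    and rad: "spectral_radius (map_mat complex_of_real E) = 1"
  obtains w k where "\<And>i. i < n \<Longrightarrow> (\<Sum>j<n. E $$ (i, j) * w j) = w i" "k < n" "w k = 1"
proof -
  let ?Ec = "map_mat complex_of_real E"
  have Ec: "?Ec \<in> carrier_mat n n" using E by simp
  obtain v where v: "v \<in> carrier_vec n" "v \<noteq> 0\<^sub>v n" "?Ec *\<^sub>v v = 1 \<cdot>\<^sub>v v"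
    using spectral_radius_one_eigenvalue[OF n E nonneg rad] E
    unfolding eigenvalue_def eigenvector_def by auto
  have fix_v: "(\<Sum>j<n. complex_of_real (E $$ (i, j)) * v $ j) = v $ i" if i: "i < n" for i
    using mult_mat_vec_index_sum[OF Ec v(1) i] v(1,3) E i by simp
  have "\<exists>k<n. v $ k \<noteq> 0" using v by (auto intro!: eq_vecI)
  then obtain k where k: "k < n" "v $ k \<noteq> 0" by blast
  \<comment> \<open>As \<open>E\<close> is real, the real and the imaginary part of \<open>v\<close> are both fixed by \<open>E\<close>; one of them does
    not vanish at \<open>k\<close>.\<close>
  define u where "u i = (if Re (v $ k) = 0 then Im (v $ i) else Re (v $ i))" for i
  have "u k \<noteq> 0" using k by (auto simp: u_def complex_eq_iff)
  have "(\<Sum>j<n. E $$ (i, j) * u j) = u i" if i: "i < n" for i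
    using arg_cong[OF fix_v[OF i], of Re] arg_cong[OF fix_v[OF i], of Im] by (auto simp: u_def)
  then have "(\<Sum>j<n. E $$ (i, j) * (u j / u k)) = u i / u k" if i: "i < n" for i
    using i by (simp add: sum_divide_distrib[symmetric])
  then show ?thesis using that[of "\<lambda>i. u i / u k" k] k \<open>u k \<noteq> 0\<close> by simp
qed

section \<open>Complemented subspaces and bounded projections\<close>

context banach_space_on
begin

lemma carrier_add: "x \<in> V \<Longrightarrow> y \<in> V \<Longrightarrow> x + y \<in> V"
  using subspace_carrier subspace_add by blast
lemma carrier_diff: "x \<in> V \<Longrightarrow> y \<in> V \<Longrightarrow> x - y \<in> V"
  using subspace_carrier subspace_diff by blast
lemma carrier_scale: "x \<in> V \<Longrightarrow> scale c x \<in> V"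
  using subspace_carrier subspace_scale by blast
lemma carrier_zero: "0 \<in> V"
  using subspace_carrier subspace_0 by blast

lemma continuous_map_iff_nrm:
  "continuous_map mtopology mtopology f \<longleftrightarrow>
    f ` V \<subseteq> V \<and>
    (\<forall>a\<in>V. \<forall>\<epsilon>>0. \<exists>\<delta>>0. \<forall>x\<in>V. nrm (a - x) < \<delta> \<longrightarrow> nrm (f a - f x) < \<epsilon>)"
  unfolding metric_continuous_map[OF Metric_space_axioms]
  by (intro conj_cong ball_cong all_cong1 imp_cong ex_cong1 refl)
    (auto simp: norm_dist_def image_subset_iff)

lemma continuous_if_bounded:
  assumes V: "f ` V \<subseteq> V" and diff: "\<And>x y. x \<in> V \<Longrightarrow> y \<in> V \<Longrightarrow> f (x - y) = f x - f y"
    and bound: "\<And>x. x \<in> V \<Longrightarrow> nrm (f x) \<le> C * nrm x"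
  shows "continuous_map mtopology mtopology f"
  unfolding continuous_map_iff_nrm
proof (intro conjI ballI allI impI)
  fix a and \<epsilon> :: real assume a: "a \<in> V" and \<epsilon>: "0 < \<epsilon>"
  let ?C = "max C 1"
  have "nrm (f a - f x) < \<epsilon>" if x: "x \<in> V" "nrm (a - x) < \<epsilon> / ?C" for x
  proof -
    have d: "a - x \<in> V" using a x carrier_diff by blast
    have "nrm (f a - f x) \<le> C * nrm (a - x)" using bound[OF d] diff a x by simp
    also have "\<dots> \<le> ?C * nrm (a - x)" using nrm_nonneg[OF d] by (intro mult_right_mono) auto
    also have "\<dots> < \<epsilon>" using x(2) by (simp add: field_simps)
    finally show ?thesis .
  qed
  then show "\<exists>\<delta>>0. \<forall>x\<in>V. nrm (a - x) < \<delta> \<longrightarrow> nrm (f a - f x) < \<epsilon>"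
    using \<epsilon> by (intro exI[of _ "\<epsilon> / ?C"]) auto
qed (use V in auto)

lemma bounded_if_continuous:
  assumes cont: "continuous_map mtopology mtopology f"
    and add: "\<And>x y. x \<in> V \<Longrightarrow> y \<in> V \<Longrightarrow> f (x + y) = f x + f y"
    and sc: "\<And>c x. x \<in> V \<Longrightarrow> f (scale c x) = scale c (f x)"
  obtains C where "\<And>x. x \<in> V \<Longrightarrow> nrm (f x) \<le> C * nrm x"
proof -
  have V: "f x \<in> V" if "x \<in> V" for x using cont that unfolding continuous_map_iff_nrm by blast
  have f0: "f 0 = 0" using add[OF carrier_zero carrier_zero] by simp
  obtain \<delta> where \<delta>: "0 < \<delta>" "\<And>x. x \<in> V \<Longrightarrow> nrm x < \<delta> \<Longrightarrow> nrm (f x) < 1"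
  proof -
    have "\<forall>\<epsilon>>0. \<exists>\<delta>>0. \<forall>x\<in>V. nrm (0 - x) < \<delta> \<longrightarrow> nrm (f 0 - f x) < \<epsilon>"
      using cont carrier_zero unfolding continuous_map_iff_nrm by blast
    from this[rule_format, of 1] obtain \<delta>
      where "0 < \<delta>" "\<forall>x\<in>V. nrm (0 - x) < \<delta> \<longrightarrow> nrm (f 0 - f x) < 1" by auto
    then show ?thesis using that[of \<delta>] nrm_minus V by (simp add: f0)
  qed
  have "nrm (f x) \<le> 2 / \<delta> * nrm x" if x: "x \<in> V" for x
  proof (cases "x = 0")
    case True
    then show ?thesis using f0 nrm_eq_0_iff[OF carrier_zero] by simp
  next
    case False
    then have pos: "0 < nrm x" using nrm_nonneg[OF x] nrm_eq_0_iff[OF x] by linarith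
    \<comment> \<open>The factor \<open>1 / 2\<close> moves \<open>c x\<close> strictly inside the ball of radius \<open>\<delta>\<close>.\<close>
    define c where "c = \<delta> / (2 * nrm x)"
    have c: "0 < c" using pos \<delta> by (simp add: c_def)
    have "nrm (scale (of_real c) x) < \<delta>"
    proof -
      have "c * nrm x < \<delta>" using pos \<delta>(1) by (simp add: c_def)
      then show ?thesis using nrm_scale[OF x, of "of_real c"] c by simp
    qed
    then have "nrm (f (scale (of_real c) x)) < 1" using \<delta>(2) carrier_scale[OF x] by blast
    then have "c * nrm (f x) < 1" using nrm_scale[OF V[OF x], of "of_real c"] sc[OF x] c by simp
    then show ?thesis using pos \<delta>(1) by (simp add: c_def field_simps)
  qed
  then show ?thesis using that by blast
qed

lemma continuous_map_plus:
  "continuous_map (prod_topology mtopology mtopology) mtopology (\<lambda>(x, y). x + y)"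
  unfolding continuous_map_to_metric
proof (intro ballI allI impI)
  fix p and \<epsilon> :: real
  assume p: "p \<in> topspace (prod_topology mtopology mtopology)" and \<epsilon>: "0 < \<epsilon>"
  obtain x y where xy: "p = (x, y)" "x \<in> V" "y \<in> V" using p by auto
  let ?U = "mball x (\<epsilon> / 2) \<times> mball y (\<epsilon> / 2)"
  have "(case q of (x, y) \<Rightarrow> x + y) \<in> mball (case p of (x, y) \<Rightarrow> x + y) \<epsilon>" if "q \<in> ?U" for q
  proof -
    obtain x' y' where q_eq: "q = (x', y')" by (cases q)
    then have q: "q = (x', y')" "x' \<in> V" "y' \<in> V" "nrm (x - x') < \<epsilon> / 2" "nrm (y - y') < \<epsilon> / 2"
      using that xy by (auto simp: norm_dist_def)
    have "nrm (x + y - (x' + y')) \<le> nrm (x - x') + nrm (y - y')"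
      using nrm_triangle[of "x - x'" "y - y'"] xy q carrier_diff by (simp add: algebra_simps)
    then show ?thesis using xy q by (simp add: norm_dist_def carrier_add)
  qed
  moreover have "openin (prod_topology mtopology mtopology) ?U"
    by (simp add: openin_prod_Times_iff)
  ultimately show "\<exists>U. openin (prod_topology mtopology mtopology) U \<and> p \<in> U \<and>
      (\<forall>y\<in>U. (case y of (x, y) \<Rightarrow> x + y) \<in> mball (case p of (x, y) \<Rightarrow> x + y) \<epsilon>)"
    using xy \<epsilon> by (intro exI[of _ ?U]) auto
qed

text \<open>The complement is the kernel of \<open>P\<close>, and \<open>x \<mapsto> (P x, x - P x)\<close> is the inverse of the
  addition map.\<close>

lemma complemented_if_projection:
  assumes "continuous_projection_onto P M"
  shows "complemented M"
proof -
  have cont: "continuous_map mtopology mtopology P"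
    and add: "\<And>x y. x \<in> V \<Longrightarrow> y \<in> V \<Longrightarrow> P (x + y) = P x + P y"
    and sc: "\<And>c x. x \<in> V \<Longrightarrow> P (scale c x) = scale c (P x)"
    and idem: "\<And>x. x \<in> V \<Longrightarrow> P (P x) = P x" and img: "P ` V = M"
    using assms unfolding continuous_projection_onto_def by auto
  have V: "P x \<in> V" if "x \<in> V" for x using cont that unfolding continuous_map_iff_nrm by blast
  have P0: "P 0 = 0" using add[OF carrier_zero carrier_zero] by simp
  have diff: "P (x - y) = P x - P y" if "x \<in> V" "y \<in> V" for x y
    using add[of "x - y" y] that carrier_diff by simp
  obtain C where C: "\<And>x. x \<in> V \<Longrightarrow> nrm (P x) \<le> C * nrm x"
    using bounded_if_continuous[OF cont add sc] by blast
  define N where "N = {x \<in> V. P x = 0}"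
  have M: "subspace M" "M \<subseteq> V"
  proof -
    show "M \<subseteq> V" using img V by blast
    show "subspace M" unfolding subspace_def
    proof (intro conjI ballI allI)
      show "0 \<in> M" using P0 img carrier_zero by force
      show "x + y \<in> M" if xy: "x \<in> M" "y \<in> M" for x y
      proof -
        obtain a b where "a \<in> V" "b \<in> V" "x = P a" "y = P b" using xy img by blast
        then show ?thesis using img add[of a b] carrier_add[of a b] by (metis imageI)
      qed
      show "scale c x \<in> M" if xM: "x \<in> M" for c x
      proof -
        obtain a where "a \<in> V" "x = P a" using xM img by blast
        then show ?thesis using img sc[of a c] carrier_scale[of a c] by (metis imageI)
      qed
    qed
  qed
  have N: "subspace N" "N \<subseteq> V"
    unfolding subspace_def N_def by (auto simp: P0 add sc carrier_zero carrier_add carrier_scale)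
  let ?T = "prod_topology (subtopology mtopology M) (subtopology mtopology N)"
  have fixM: "P x = x" if "x \<in> M" for x using that idem img by auto
  have "homeomorphic_maps ?T mtopology (\<lambda>(x, y). x + y) (\<lambda>x. (P x, x - P x))"
    unfolding homeomorphic_maps_def
  proof (intro conjI ballI)
    show "continuous_map ?T mtopology (\<lambda>(x, y). x + y)"
      unfolding prod_topology_subtopology subtopology_subtopology
      by (intro continuous_map_from_subtopology continuous_map_plus)
    have "continuous_map mtopology mtopology (\<lambda>x. x - P x)"
    proof (rule continuous_if_bounded[where C = "1 + C"])
      fix x assume x: "x \<in> V"
      have "nrm (x - P x) \<le> nrm x + nrm (P x)"
        using nrm_triangle[of x "- P x"] nrm_minus[OF V[OF x]] x V carrier_diff[OF carrier_zero V[OF x]]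
        by simp
      then show "nrm (x - P x) \<le> (1 + C) * nrm x" using C[OF x] by (simp add: algebra_simps)
    qed (auto simp: diff V carrier_diff)
    then show "continuous_map mtopology ?T (\<lambda>x. (P x, x - P x))"
      using img V idem
      by (auto simp: continuous_map_paired continuous_map_in_subtopology cont N_def carrier_diff diff)
    show "(case (P x, x - P x) of (x, y) \<Rightarrow> x + y) = x" if "x \<in> topspace mtopology" for x
      by simp
    fix z assume "z \<in> topspace ?T"
    then obtain x y where z: "z = (x, y)" "x \<in> M" "y \<in> N" by auto
    then have "P (x + y) = x" using add[of x y] fixM M N by (auto simp: N_def)
    then show "(P (case z of (x, y) \<Rightarrow> x + y), (case z of (x, y) \<Rightarrow> x + y) - P (case z of (x, y) \<Rightarrow> x + y)) = z"
      using z by simp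
  qed
  then have "homeomorphic_map ?T mtopology (\<lambda>(x, y). x + y)"
    by (rule homeomorphic_maps_imp_map)
  then have "topological_direct_sum M N"
    using M N unfolding topological_direct_sum_def by (intro conjI)
  then show ?thesis unfolding complemented_def by (rule exI)
qed

lemma projection_if_complemented:
  assumes "complemented M"
  obtains P where "continuous_projection_onto P M"
proof -
  obtain N where M: "M \<subseteq> V" "subspace M" and N: "N \<subseteq> V" "subspace N"
    and homeo: "homeomorphic_map (prod_topology (subtopology mtopology M) (subtopology mtopology N))
       mtopology (\<lambda>(x, y). x + y)"
    using assms unfolding complemented_def topological_direct_sum_def by auto
  let ?T = "prod_topology (subtopology mtopology M) (subtopology mtopology N)"
  have top: "topspace ?T = M \<times> N" using M N by auto
  obtain g where maps: "homeomorphic_maps ?T mtopology (\<lambda>(x, y). x + y) g"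
    using homeo unfolding homeomorphic_map_maps by blast
  have g: "continuous_map mtopology ?T g"
    using maps unfolding homeomorphic_maps_def by blast
  have gl: "g (case z of (x, y) \<Rightarrow> x + y) = z" if "z \<in> M \<times> N" for z
    using maps that top unfolding homeomorphic_maps_def by blast
  have gr: "(case g x of (x, y) \<Rightarrow> x + y) = x" if "x \<in> V" for x
    using maps that topspace_mtopology unfolding homeomorphic_maps_def by blast
  have gMN: "g x \<in> M \<times> N" if "x \<in> V" for x
    using continuous_map_image_subset_topspace[OF g] that top topspace_mtopology by blast
  define P where "P = fst \<circ> g"
  have P: "P x = a" if "x = a + b" "a \<in> M" "b \<in> N" for x a b
    using gl[of "(a, b)"] that by (simp add: P_def)
  have dec: "\<exists>a b. x = a + b \<and> a \<in> M \<and> b \<in> N" if "x \<in> V" for x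
    using gMN[OF that] gr[OF that] by (cases "g x") auto
  have "continuous_map mtopology (subtopology mtopology M) P"
    unfolding P_def using g continuous_map_compose continuous_map_fst by blast
  then have cont: "continuous_map mtopology mtopology P" by (simp add: continuous_map_in_subtopology)
  have add: "P (x + y) = P x + P y" if xy: "x \<in> V" "y \<in> V" for x y
  proof -
    obtain a b c d where *: "x = a + b" "a \<in> M" "b \<in> N" "y = c + d" "c \<in> M" "d \<in> N"
      using dec xy by meson
    have "P (x + y) = a + c"
      using * by (intro P[of _ _ "b + d"]) (auto simp: subspace_add[OF M(2)] subspace_add[OF N(2)])
    then show ?thesis using P[of x a b] P[of y c d] * by simp
  qed
  have sc: "P (scale r x) = scale r (P x)" if x: "x \<in> V" for r x
  proof -
    obtain a b where *: "x = a + b" "a \<in> M" "b \<in> N" using dec x by meson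
    have "P (scale r x) = scale r a"
      using * by (intro P[of _ _ "scale r b"])
        (auto simp: scale_right_distrib subspace_scale[OF M(2)] subspace_scale[OF N(2)])
    then show ?thesis using P[of x a b] * by simp
  qed
  have PM: "P x = x" if "x \<in> M" for x
    using P[of x x 0] that subspace_0[OF N(2)] by simp
  have PV: "P x \<in> M" if "x \<in> V" for x
    using gMN[OF that] by (auto simp: P_def mem_Times_iff)
  have "P ` V = M"
  proof
    show "P ` V \<subseteq> M" using PV by blast
    show "M \<subseteq> P ` V" using PM M(1) by (metis imageI subsetD subsetI)
  qed
  then have "continuous_projection_onto P M"
    unfolding continuous_projection_onto_def using cont add sc PM PV by blast
  then show ?thesis by (rule that)
qed

end

section \<open>Bounded sequences and null sequences\<close>

definition sup_norm :: "(nat \<Rightarrow> 'k::real_normed_field) \<Rightarrow> real" where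
  "sup_norm u = (SUP m. norm (u m))"

lemma seq_scale_apply: "seq_scale c u m = c * u m"
  by (simp add: seq_scale_def)

lemma norm_le_sup_norm: "Bseq u \<Longrightarrow> norm (u m) \<le> sup_norm u"
  unfolding sup_norm_def
  by (rule cSUP_upper) (auto simp: Bseq_def bdd_above_def)

lemma sup_norm_le: "(\<And>m. norm (u m) \<le> c) \<Longrightarrow> sup_norm u \<le> c"
  unfolding sup_norm_def by (rule cSUP_least) auto

definition null_seqs :: "(nat \<Rightarrow> 'k::real_normed_field) set" where
  "null_seqs = {u. u \<longlonglongrightarrow> 0}"

lemma null_seqs_Bseq: "u \<in> null_seqs \<Longrightarrow> Bseq u"
  unfolding null_seqs_def by (auto intro: convergent_imp_Bseq convergentI)

lemma Bseq_plus:
  assumes "Bseq u" "Bseq v"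
  shows "Bseq (u + v :: nat \<Rightarrow> 'k::real_normed_vector)"
proof -
  obtain K L where "\<And>m. norm (u m) \<le> K" "\<And>m. norm (v m) \<le> L"
    using assms by (auto simp: Bseq_def)
  then show ?thesis
    by (intro BseqI'[of _ "K + L"]) (auto intro: norm_triangle_mono)
qed

lemma Bseq_seq_scale: "Bseq u \<Longrightarrow> Bseq (seq_scale c u)" for c :: "'k::real_normed_field"
  unfolding seq_scale_def by (intro Bseq_mult) auto

lemma sum_fun_apply: "(\<Sum>i\<in>A. f i) m = (\<Sum>i\<in>A. f i m)"
  for f :: "'a \<Rightarrow> 'b \<Rightarrow> 'c::comm_monoid_add"
  by (induction A rule: infinite_finite_induct) auto

interpretation seqs: vector_space seq_scale
  by standard (auto simp: seq_scale_def fun_eq_iff algebra_simps)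

lemma null_seqs_add: "u \<in> null_seqs \<Longrightarrow> v \<in> null_seqs \<Longrightarrow> u + v \<in> null_seqs"
  unfolding null_seqs_def plus_fun_def using tendsto_add[of u 0 sequentially v 0] by simp

lemma null_seqs_diff: "u \<in> null_seqs \<Longrightarrow> v \<in> null_seqs \<Longrightarrow> u - v \<in> null_seqs"
  unfolding null_seqs_def fun_diff_def using tendsto_diff[of u 0 sequentially v 0] by simp

lemma null_seqs_zero: "0 \<in> null_seqs"
  by (simp add: null_seqs_def zero_fun_def)

lemma null_seqs_sum: "(\<And>i. i \<in> A \<Longrightarrow> f i \<in> null_seqs) \<Longrightarrow> (\<Sum>i\<in>A. f i) \<in> null_seqs"
  by (induction A rule: infinite_finite_induct) (auto simp: null_seqs_zero null_seqs_add)

lemma null_seqs_scale: "u \<in> null_seqs \<Longrightarrow> seq_scale c u \<in> null_seqs"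
  unfolding null_seqs_def seq_scale_def using tendsto_mult_right_zero[of u sequentially c] by simp

lemma null_seqs_dominated:
  assumes "v \<in> null_seqs" "\<And>m. norm (u m) \<le> c * norm (v m)"
  shows "u \<in> null_seqs"
proof -
  have lim: "(\<lambda>m. c * norm (v m)) \<longlonglongrightarrow> 0"
    using assms(1) unfolding null_seqs_def by (auto intro: tendsto_mult_right_zero tendsto_norm_zero)
  have "\<forall>\<^sub>F m in sequentially. norm (u m) \<le> c * norm (v m)"
    using assms(2) by (intro always_eventually allI)
  from Lim_null_comparison[OF this lim] show ?thesis
    by (simp add: null_seqs_def)
qed

text \<open>The null sequences are closed under uniform approximation. This serves both for the completeness of
  the ambient space constructed below and for the closedness of the sum of its subspaces.\<close>

lemma null_seqs_uniform_limit:
  assumes "\<And>\<epsilon>. 0 < \<epsilon> \<Longrightarrow> \<exists>v\<in>null_seqs. \<forall>m. norm (u m - v m) \<le> \<epsilon>"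
  shows "u \<in> null_seqs"
  unfolding null_seqs_def
proof (rule CollectI, rule LIMSEQ_I)
  fix r :: real assume r: "0 < r"
  obtain v where v: "v \<longlonglongrightarrow> 0" "\<And>m. norm (u m - v m) \<le> r / 2"
    using assms[of "r / 2"] r by (auto simp: null_seqs_def)
  obtain N where N: "\<And>m. m \<ge> N \<Longrightarrow> norm (v m) < r / 2"
    using LIMSEQ_D[OF v(1), of "r / 2"] r by auto
  have "norm (u m - 0) < r" if "m \<ge> N" for m
    using norm_triangle_ineq[of "u m - v m" "v m"] v(2)[of m] N[OF that] by simp
  then show "\<exists>N. \<forall>m\<ge>N. norm (u m - 0) < r" by blast
qed

lemma sup_norm_nonneg: "Bseq u \<Longrightarrow> 0 \<le> sup_norm u"
  using norm_le_sup_norm[of u 0] norm_ge_zero order_trans by blast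

lemma sup_norm_eq_0_iff:
  assumes "Bseq u"
  shows "sup_norm u = 0 \<longleftrightarrow> u = 0"
proof
  assume "sup_norm u = 0"
  then have "u m = 0" for m using norm_le_sup_norm[OF assms, of m] by simp
  then show "u = 0" by (simp add: fun_eq_iff)
qed (simp add: sup_norm_def)

lemma sup_norm_triangle:
  assumes "Bseq u" "Bseq v"
  shows "sup_norm (u + v) \<le> sup_norm u + sup_norm v"
  using norm_le_sup_norm[OF assms(1)] norm_le_sup_norm[OF assms(2)]
  by (intro sup_norm_le) (auto intro: norm_triangle_mono)

lemma sup_norm_scale:
  assumes "Bseq u"
  shows "sup_norm (seq_scale c u) = norm c * sup_norm u"
proof (cases "c = 0")
  case True
  then show ?thesis by (simp add: sup_norm_def seq_scale_def)
next
  case False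
  have B: "Bseq (seq_scale c u)" using assms by (rule Bseq_seq_scale)
  have "sup_norm u \<le> sup_norm (seq_scale c u) / norm c"
    using norm_le_sup_norm[OF B] False
    by (intro sup_norm_le) (simp add: field_simps seq_scale_def norm_mult)
  moreover have "sup_norm (seq_scale c u) \<le> norm c * sup_norm u"
    using norm_le_sup_norm[OF assms]
    by (intro sup_norm_le) (simp add: seq_scale_def norm_mult mult_left_mono)
  ultimately show ?thesis using False by (simp add: field_simps)
qed

text \<open>A closed subspace of \<open>\<ell>\<^sup>\<infinity>\<close> is a Banach space. Closedness is phrased by uniform approximation, so
  that no topology on the sequences is involved.\<close>

lemma banach_space_on_sup_norm:
  fixes V :: "(nat \<Rightarrow> 'k::{real_normed_field, banach}) set"
  assumes V: "seqs.subspace V" and B: "\<And>u. u \<in> V \<Longrightarrow> Bseq u"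
    and closed: "\<And>u. (\<And>\<epsilon>. 0 < \<epsilon> \<Longrightarrow> \<exists>v\<in>V. \<forall>m. norm (u m - v m) \<le> \<epsilon>) \<Longrightarrow> u \<in> V"
  shows "banach_space_on seq_scale V sup_norm"
proof -
  have diff: "u - v \<in> V" if "u \<in> V" "v \<in> V" for u v using V that seqs.subspace_diff by blast
  interpret M: Metric_space V "norm_dist V sup_norm"
  proof
    show "0 \<le> norm_dist V sup_norm u v" for u v
      by (auto simp: norm_dist_def intro: sup_norm_nonneg B diff)
    show "norm_dist V sup_norm u v = norm_dist V sup_norm v u" for u v
      by (simp add: norm_dist_def sup_norm_def norm_minus_commute)
    show "norm_dist V sup_norm u v = 0 \<longleftrightarrow> u = v" if "u \<in> V" "v \<in> V" for u v
      using that sup_norm_eq_0_iff[OF B[OF diff[OF that]]] by (simp add: norm_dist_def)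
    show "norm_dist V sup_norm x z \<le> norm_dist V sup_norm x y + norm_dist V sup_norm y z"
      if "x \<in> V" "y \<in> V" "z \<in> V" for x y z
      using that sup_norm_triangle[of "x - y" "y - z"] B diff by (simp add: norm_dist_def)
  qed
  have "M.mcomplete"
    unfolding M.mcomplete_def
  proof (intro allI impI)
    fix \<sigma> assume \<sigma>: "M.MCauchy \<sigma>"
    have \<sigma>V: "\<sigma> p \<in> V" for p using \<sigma> by (auto simp: M.MCauchy_def)
    have Cauchy: "\<exists>N. \<forall>p\<ge>N. \<forall>q\<ge>N. \<forall>m. norm (\<sigma> p m - \<sigma> q m) < \<epsilon>" if \<epsilon>: "0 < \<epsilon>" for \<epsilon>
    proof -
      obtain N where N: "\<And>p q. N \<le> p \<Longrightarrow> N \<le> q \<Longrightarrow> norm_dist V sup_norm (\<sigma> p) (\<sigma> q) < \<epsilon>"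
        using \<sigma> \<epsilon> unfolding M.MCauchy_def by blast
      have "norm (\<sigma> p m - \<sigma> q m) < \<epsilon>" if "N \<le> p" "N \<le> q" for p q m
        using N[OF that] norm_le_sup_norm[OF B[OF diff[OF \<sigma>V \<sigma>V]], of p q m] \<sigma>V
        by (simp add: norm_dist_def)
      then show ?thesis by blast
    qed
    have "Cauchy (\<lambda>p. \<sigma> p m)" for m
      using Cauchy by (intro CauchyI) meson
    then have "\<forall>m. \<exists>a. (\<lambda>p. \<sigma> p m) \<longlonglongrightarrow> a"
      by (simp add: Cauchy_convergent_iff convergent_def)
    from choice[OF this] obtain l where l: "\<And>m. (\<lambda>p. \<sigma> p m) \<longlonglongrightarrow> l m" by blast
    have unif: "\<exists>N. \<forall>p\<ge>N. \<forall>m. norm (\<sigma> p m - l m) \<le> \<epsilon>" if \<epsilon>: "0 < \<epsilon>" for \<epsilon>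
    proof -
      obtain N where N: "\<And>p q m. N \<le> p \<Longrightarrow> N \<le> q \<Longrightarrow> norm (\<sigma> p m - \<sigma> q m) < \<epsilon>"
        using Cauchy[OF \<epsilon>] by blast
      have "norm (\<sigma> p m - l m) \<le> \<epsilon>" if p: "N \<le> p" for p m
      proof (rule LIMSEQ_le_const2)
        show "(\<lambda>q. norm (\<sigma> p m - \<sigma> q m)) \<longlonglongrightarrow> norm (\<sigma> p m - l m)"
          by (intro tendsto_intros l)
        show "\<exists>N. \<forall>q\<ge>N. norm (\<sigma> p m - \<sigma> q m) \<le> \<epsilon>"
          using N[OF p] less_imp_le by blast
      qed
      then show ?thesis by blast
    qed
    have lV: "l \<in> V"
    proof (rule closed)
      fix \<epsilon> :: real assume "0 < \<epsilon>"
      then obtain N where "\<forall>m. norm (\<sigma> N m - l m) \<le> \<epsilon>" using unif by blast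
      then show "\<exists>v\<in>V. \<forall>m. norm (l m - v m) \<le> \<epsilon>"
        using \<sigma>V by (intro bexI[of _ "\<sigma> N"]) (simp_all add: norm_minus_commute)
    qed
    have "limitin M.mtopology \<sigma> l sequentially"
      unfolding M.limit_metric_sequentially
    proof (intro conjI allI impI lV)
      fix \<epsilon> :: real assume \<epsilon>: "0 < \<epsilon>"
      then obtain N where N: "\<And>p m. N \<le> p \<Longrightarrow> norm (\<sigma> p m - l m) \<le> \<epsilon> / 2"
        using unif[of "\<epsilon> / 2"] by auto
      have "norm_dist V sup_norm (\<sigma> p) l < \<epsilon>" if "N \<le> p" for p
        using sup_norm_le[of "\<sigma> p - l" "\<epsilon> / 2"] N[OF that] \<epsilon> by (simp add: norm_dist_def)
      then show "\<exists>N. \<forall>p\<ge>N. \<sigma> p \<in> V \<and> norm_dist V sup_norm (\<sigma> p) l < \<epsilon>" using \<sigma>V by blast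
    qed
    then show "\<exists>l. limitin M.mtopology \<sigma> l sequentially" by blast
  qed
  then show ?thesis
    using V B by unfold_locales (simp_all add: sup_norm_eq_0_iff sup_norm_scale sup_norm_triangle)
qed

section \<open>The null sequences are not complemented in the bounded sequences\<close>

text \<open>The codes of the initial segments of \<open>S\<close>, that is, a branch of the infinite binary tree. The
  length \<open>q\<close> is part of the code, since distinct initial segments may coincide as sets. Two branches
  share only the segments before the point where they separate, so the branches form an uncountable
  almost disjoint family.\<close>

definition branch :: "nat set \<Rightarrow> nat set" where
  "branch S = range (\<lambda>q. prod_encode (q, set_encode (S \<inter> {..<q})))"

lemma infinite_branch: "infinite (branch S)"
  unfolding branch_def
  by (rule range_inj_infinite) (auto simp: inj_on_def prod_encode_eq)

lemma finite_branch_Int: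
  assumes "S \<noteq> T"
  shows "finite (branch S \<inter> branch T)"
proof -
  obtain m where m: "m \<in> S \<longleftrightarrow> m \<notin> T" using assms by blast
  have "branch S \<inter> branch T \<subseteq> (\<lambda>q. prod_encode (q, set_encode (S \<inter> {..<q}))) ` {..m}"
  proof
    fix z assume "z \<in> branch S \<inter> branch T"
    then obtain q where z: "z = prod_encode (q, set_encode (S \<inter> {..<q}))"
      and "set_encode (S \<inter> {..<q}) = set_encode (T \<inter> {..<q})"
      by (auto simp: branch_def prod_encode_eq)
    then have "S \<inter> {..<q} = T \<inter> {..<q}" by (simp add: set_encode_eq)
    with m have "q \<le> m" by (metis IntI Int_iff lessThan_iff not_le)
    then show "z \<in> (\<lambda>q. prod_encode (q, set_encode (S \<inter> {..<q}))) ` {..m}" using z by blast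
  qed
  then show ?thesis by (rule finite_subset) simp
qed

lemma uncountable_nat_sets: "uncountable (UNIV :: nat set set)"
proof
  assume "countable (UNIV :: nat set set)"
  then obtain f :: "nat \<Rightarrow> nat set" where "range f = UNIV"
    using uncountable_def by (metis UNIV_not_empty)
  then show False using Cantors_theorem[of "UNIV :: nat set"] by auto
qed

text \<open>If \<open>f\<close> is at least \<open>\<epsilon>\<close> in norm at the indicators of the finitely many branches in \<open>F\<close>, unimodular
  coefficients \<open>c\<close> turn \<open>f\<close> of the combination \<open>x\<close> of these indicators into the sum of the norms,
  which is at least \<open>card F * \<epsilon>\<close>. By almost disjointness \<open>x\<close> differs from a sequence of norm at most 1
  by a finitely supported one, which \<open>f\<close> does not see. So \<open>card F\<close> is bounded in terms of \<open>\<epsilon>\<close>.\<close>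

lemma countable_functional_nonzero:
  fixes f :: "(nat \<Rightarrow> 'k::real_normed_field) \<Rightarrow> 'k"
  assumes add: "\<And>u v. Bseq u \<Longrightarrow> Bseq v \<Longrightarrow> f (u + v) = f u + f v"
    and scale: "\<And>c u. Bseq u \<Longrightarrow> f (seq_scale c u) = c * f u"
    and bound: "\<And>u. Bseq u \<Longrightarrow> norm (f u) \<le> C * sup_norm u"
    and null: "\<And>u. u \<in> null_seqs \<Longrightarrow> f u = 0"
  shows "countable {S. f (indicator (branch S)) \<noteq> 0}"
proof -
  let ?a = "\<lambda>S. indicator (branch S) :: nat \<Rightarrow> 'k"
  have Bseq_a: "Bseq (?a S)" for S by (intro BseqI'[of _ 1]) (auto simp: indicator_def)
  have C: "0 \<le> C"
  proof -
    have B: "Bseq (\<lambda>_. 1 :: 'k)" by (intro BseqI'[of _ 1]) auto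
    have "sup_norm (\<lambda>_. 1 :: 'k) = 1" by (simp add: sup_norm_def)
    then show ?thesis using bound[OF B] by (simp add: order.trans[OF norm_ge_zero])
  qed
  have card_le: "real (card F) * \<epsilon> \<le> C"
    if fin: "finite F" and eps: "\<And>S. S \<in> F \<Longrightarrow> \<epsilon> \<le> norm (f (?a S))" and pos: "0 < \<epsilon>" for F \<epsilon>
  proof -
    define c where "c S = of_real (norm (f (?a S))) / f (?a S)" for S
    define x where "x = (\<Sum>S\<in>F. seq_scale (c S) (?a S))"
    have c: "norm (c S) = 1" "c S * f (?a S) = of_real (norm (f (?a S)))" if "S \<in> F" for S
      using eps[OF that] pos by (auto simp: c_def norm_divide)
    have "Bseq (\<Sum>S\<in>G. seq_scale (c S) (?a S)) \<and>
        f (\<Sum>S\<in>G. seq_scale (c S) (?a S)) = (\<Sum>S\<in>G. c S * f (?a S))" if "finite G" for G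
      using that
    proof (induction G rule: finite_induct)
      case empty
      have "(0 :: nat \<Rightarrow> 'k) \<in> null_seqs" by (simp add: null_seqs_def zero_fun_def)
      then show ?case using null null_seqs_Bseq unfolding sum.empty by blast
    next
      case (insert S G)
      have B: "Bseq (seq_scale (c S) (?a S))" using Bseq_seq_scale[OF Bseq_a] .
      have "f (seq_scale (c S) (?a S) + (\<Sum>S\<in>G. seq_scale (c S) (?a S))) =
          c S * f (?a S) + (\<Sum>S\<in>G. c S * f (?a S))"
        using add[OF B conjunct1[OF insert.IH]] insert.IH scale[OF Bseq_a] by metis
      then show ?case
        unfolding sum.insert[OF insert.hyps] using Bseq_plus[OF B] insert.IH by blast
    qed
    from this[OF fin] have Bx: "Bseq x" and fx: "f x = (\<Sum>S\<in>F. c S * f (?a S))"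
      by (auto simp: x_def)
    have "finite (\<Union>S\<in>F. \<Union>T\<in>F - {S}. branch S \<inter> branch T)"
      using fin by (intro finite_UN_I finite_branch_Int) auto
    then obtain N where N: "\<forall>z\<in>(\<Union>S\<in>F. \<Union>T\<in>F - {S}. branch S \<inter> branch T). z < N"
      unfolding finite_nat_set_iff_bounded by (rule exE)
    \<comment> \<open>Beyond \<open>N\<close> the branches in \<open>F\<close> are disjoint; \<open>x\<close> is split at \<open>N\<close> into \<open>t\<close> and \<open>y\<close>.\<close>
    define t where "t m = (if m < N then x m else 0)" for m
    have t: "t \<in> null_seqs"
      unfolding null_seqs_def t_def
      by (auto intro!: tendsto_eventually eventually_sequentiallyI[of N])
    define y where "y m = (if m < N then 0 else x m)" for m
    have xm: "x m = (\<Sum>S\<in>F. c S * ?a S m)" for m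
      by (simp add: x_def sum_fun_apply seq_scale_def)
    have y1: "norm (y m) \<le> 1" for m
    proof (cases "m < N \<or> (\<forall>S\<in>F. m \<notin> branch S)")
      case True
      then show ?thesis by (auto simp: y_def xm)
    next
      case False
      then obtain S where S: "S \<in> F" "m \<in> branch S" "\<not> m < N" by blast
      then have "\<forall>T\<in>F - {S}. m \<notin> branch T" using N by blast
      then have "x m = (\<Sum>T\<in>F. if T = S then c S else 0)"
        unfolding xm using S by (intro sum.cong) (auto simp: indicator_def)
      then have "x m = c S" using fin S by simp
      then show ?thesis using S c by (simp add: y_def)
    qed
    have "x = y + t" by (auto simp: fun_eq_iff y_def t_def)
    moreover have By: "Bseq y" using y1 by (auto intro: BseqI')
    ultimately have "f x = f y" using add[OF By null_seqs_Bseq[OF t]] null[OF t] by simp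
    then have "norm (f x) \<le> C"
      using bound[OF By] mult_left_mono[OF sup_norm_le[of y 1, OF y1] C] by simp
    moreover have "f x = of_real (\<Sum>S\<in>F. norm (f (?a S)))" by (simp add: fx c)
    moreover have "real (card F) * \<epsilon> \<le> (\<Sum>S\<in>F. norm (f (?a S)))"
      using sum_mono[of F "\<lambda>_. \<epsilon>"] eps by simp
    ultimately show ?thesis
      by (metis (no_types, lifting) abs_ge_self norm_of_real order_trans)
  qed
  have fin: "finite {S. 1 / real (Suc q) \<le> norm (f (?a S))}" for q
  proof (rule ccontr)
    obtain p where p: "C * real (Suc q) < real p" using reals_Archimedean2 by blast
    assume "infinite {S. 1 / real (Suc q) \<le> norm (f (?a S))}"
    then obtain F where F: "F \<subseteq> {S. 1 / real (Suc q) \<le> norm (f (?a S))}" "finite F" "card F = p"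
      using infinite_arbitrarily_large by blast
    then have "real p * (1 / real (Suc q)) \<le> C" using card_le[of F "1 / real (Suc q)"] by auto
    with p show False by (simp add: divide_simps)
  qed
  have "{S. f (?a S) \<noteq> 0} \<subseteq> (\<Union>q. {S. 1 / real (Suc q) \<le> norm (f (?a S))})"
  proof
    fix S assume "S \<in> {S. f (?a S) \<noteq> 0}"
    then have "0 < norm (f (?a S))" by simp
    then obtain q where "inverse (real (Suc q)) < norm (f (?a S))" using reals_Archimedean by blast
    then show "S \<in> (\<Union>q. {S. 1 / real (Suc q) \<le> norm (f (?a S))})"
      by (auto simp: inverse_eq_divide intro: less_imp_le)
  qed
  then show ?thesis
    by (rule countable_subset) (intro countable_UN countableI_type countable_finite fin)
qed

text \<open>The theorem of Phillips, by Whitley's argument. Each coordinate of \<open>id - Q\<close> is a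
  bounded functional that vanishes on the null sequences, so it vanishes at the indicators of all but
  countably many branches. There are uncountably many branches and only countably many coordinates;
  hence \<open>Q\<close> fixes the indicator of some branch, which is not a null sequence.\<close>

lemma no_bounded_projection_onto_null_seqs:
  fixes Q :: "(nat \<Rightarrow> 'k::real_normed_field) \<Rightarrow> nat \<Rightarrow> 'k"
  assumes add: "\<And>u v. Bseq u \<Longrightarrow> Bseq v \<Longrightarrow> Q (u + v) = Q u + Q v"
    and scale: "\<And>c u. Bseq u \<Longrightarrow> Q (seq_scale c u) = seq_scale c (Q u)"
    and bound: "\<And>u. Bseq u \<Longrightarrow> sup_norm (Q u) \<le> C * sup_norm u"
    and range: "\<And>u. Bseq u \<Longrightarrow> Q u \<in> null_seqs"
    and fixed: "\<And>u. u \<in> null_seqs \<Longrightarrow> Q u = u"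
  shows False
proof -
  have "countable {S. indicator (branch S) m - Q (indicator (branch S)) m \<noteq> 0}" for m
  proof (rule countable_functional_nonzero[where f = "\<lambda>u. u m - Q u m" and C = "1 + C"])
    fix u :: "nat \<Rightarrow> 'k" assume u: "Bseq u"
    have "norm (u m - Q u m) \<le> norm (u m) + norm (Q u m)" by (rule norm_triangle_ineq4)
    also have "\<dots> \<le> sup_norm u + C * sup_norm u"
      using norm_le_sup_norm[OF u, of m] norm_le_sup_norm[OF null_seqs_Bseq[OF range[OF u]], of m]
        bound[OF u] by simp
    finally show "norm (u m - Q u m) \<le> (1 + C) * sup_norm u" by (simp add: algebra_simps)
  qed (auto simp: add scale fixed seq_scale_apply algebra_simps)
  then have "countable (\<Union>m. {S. indicator (branch S) m - Q (indicator (branch S)) m \<noteq> 0})"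
    by blast
  with uncountable_nat_sets
  have "(\<Union>m. {S. indicator (branch S) m - Q (indicator (branch S)) m \<noteq> 0}) \<noteq> UNIV" by auto
  then obtain S where S: "S \<notin> (\<Union>m. {S. indicator (branch S) m - Q (indicator (branch S)) m \<noteq> 0})"
    by blast
  then have "Q (indicator (branch S)) = indicator (branch S)" by (auto simp: fun_eq_iff)
  moreover have "Bseq (indicator (branch S) :: nat \<Rightarrow> 'k)"
    by (intro BseqI'[of _ 1]) (auto simp: indicator_def)
  ultimately have "(indicator (branch S) :: nat \<Rightarrow> 'k) \<longlonglongrightarrow> 0"
    using range[of "indicator (branch S)"] by (simp add: null_seqs_def)
  then obtain N where N: "\<And>m. m \<ge> N \<Longrightarrow> norm (indicator (branch S) m :: 'k) < 1"
    using LIMSEQ_D[of _ 0 1] by fastforce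
  obtain m where "m \<in> branch S" "m \<ge> N"
    using infinite_branch[of S] by (metis infinite_nat_iff_unbounded_le)
  with N show False by force
qed

section \<open>The ambient space\<close>

text \<open>A sequence \<open>u\<close> encodes the \<open>n\<close> sequences \<open>q \<mapsto> u (q * n + i)\<close>, \<open>i < n\<close>: the entry at \<open>m\<close>
  belongs to the component \<open>m mod n\<close> and is at place \<open>m div n\<close> in it. This identifies \<open>\<ell>\<^sup>\<infinity>\<close> with its
  \<open>n\<close>-th power and \<open>c\<^sub>0\<close> with its own.\<close>

locale eigenvector_construction =
  fixes n k :: nat and e :: "nat \<Rightarrow> nat \<Rightarrow> real" and w :: "nat \<Rightarrow> real"
  assumes k: "k < n" and w_k: "w k = 1"
    and eigen: "\<And>i. i < n \<Longrightarrow> (\<Sum>j<n. e i j * w j) = w i"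
    and e_diag: "\<And>i. i < n \<Longrightarrow> e i i = 0"
    and e_nonneg: "\<And>i j. i < n \<Longrightarrow> j < n \<Longrightarrow> i \<noteq> j \<Longrightarrow> 0 \<le> e i j"
begin

text \<open>The index of the entry of component \<open>j\<close> that is at the same place as the entry at \<open>m\<close>.\<close>

definition slot :: "nat \<Rightarrow> nat \<Rightarrow> nat" where "slot m j = m div n * n + j"

text \<open>Subtracts from \<open>u\<close> the multiple of \<open>w\<close> that agrees with it in component \<open>k\<close>, where \<open>w k = 1\<close>.
  Thus, for bounded \<open>u\<close>, \<open>defect u\<close> is null precisely if \<open>u\<close> lies in \<open>c\<^sub>0\<^sup>n + w \<otimes> \<ell>\<^sup>\<infinity>\<close>. Unlike that sum, a
  condition on \<open>defect u\<close> is visibly preserved by uniform limits.\<close>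

definition defect :: "(nat \<Rightarrow> 'k::{real_normed_field, banach}) \<Rightarrow> nat \<Rightarrow> 'k" where
  "defect u m = u m - of_real (w (m mod n)) * u (slot m k)"

definition ambient :: "(nat \<Rightarrow> 'k::{real_normed_field, banach}) set" where
  "ambient = {u. Bseq u \<and> defect u \<in> null_seqs}"

definition component :: "nat \<Rightarrow> (nat \<Rightarrow> 'k::{real_normed_field, banach}) set" where
  "component i = {u \<in> null_seqs. \<forall>m. m mod n \<noteq> i \<longrightarrow> u m = 0}"

text \<open>The component \<open>i\<close> of \<open>(1 - E) u\<close>. The minus sign puts \<open>w \<otimes> \<ell>\<^sup>\<infinity>\<close> into the kernel, and it disappears
  in the norm.\<close>

definition proj :: "nat \<Rightarrow> (nat \<Rightarrow> 'k::{real_normed_field, banach}) \<Rightarrow> nat \<Rightarrow> 'k" where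
  "proj i u m = (if m mod n = i then u m - (\<Sum>j<n. of_real (e i j) * u (slot m j)) else 0)"

text \<open>The sequence \<open>w \<otimes> z\<close>.\<close>

definition embed :: "(nat \<Rightarrow> 'k::{real_normed_field, banach}) \<Rightarrow> nat \<Rightarrow> 'k" where
  "embed z m = of_real (w (m mod n)) * z (m div n)"

definition weight_bound :: real where "weight_bound = (\<Sum>i<n. \<bar>w i\<bar>)"

lemma n_pos: "0 < n" using k by simp

lemma slot_mod: "j < n \<Longrightarrow> slot m j mod n = j" by (simp add: slot_def)
lemma slot_div: "j < n \<Longrightarrow> slot m j div n = m div n" by (simp add: slot_def)
lemma slot_slot: "j < n \<Longrightarrow> slot (slot m j) i = slot m i" using slot_div by (simp add: slot_def)
lemma slot_self: "slot m (m mod n) = m" by (simp add: slot_def)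

lemma w_le: "i < n \<Longrightarrow> \<bar>w i\<bar> \<le> weight_bound"
  unfolding weight_bound_def by (rule member_le_sum) auto

lemma weight_bound_nonneg: "0 \<le> weight_bound" by (simp add: weight_bound_def sum_nonneg)

lemma filterlim_slot: "filterlim (\<lambda>m. slot m j) at_top sequentially"
  unfolding filterlim_at_top
proof
  fix Z
  have "Z \<le> slot m j" if "Z + n \<le> m" for m
    using that mod_less_divisor[OF n_pos, of m] div_mult_mod_eq[of m n] unfolding slot_def by linarith
  then show "\<forall>\<^sub>F m in sequentially. Z \<le> slot m j" by (rule eventually_sequentiallyI)
qed

lemma null_seqs_slot: "u \<in> null_seqs \<Longrightarrow> (\<lambda>m. u (slot m j)) \<in> null_seqs"
  unfolding null_seqs_def mem_Collect_eq by (rule filterlim_compose[OF _ filterlim_slot])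

lemma norm_defect_le:
  assumes "\<And>m. norm (u m) \<le> c"
  shows "norm (defect u m) \<le> (1 + weight_bound) * c"
proof -
  have "norm (defect u m) \<le> norm (u m) + \<bar>w (m mod n)\<bar> * norm (u (slot m k))"
    unfolding defect_def using norm_triangle_ineq4[of "u m"] by (metis norm_mult norm_of_real)
  also have "\<dots> \<le> c + weight_bound * c"
    using assms w_le n_pos weight_bound_nonneg by (intro add_mono mult_mono) auto
  finally show ?thesis by (simp add: algebra_simps)
qed

lemma defect_add: "defect (u + v) = defect u + defect v"
  by (rule ext) (simp add: defect_def algebra_simps)

lemma defect_diff: "defect (u - v) = defect u - defect v"
  by (rule ext) (simp add: defect_def algebra_simps)

lemma defect_scale: "defect (seq_scale c u) = seq_scale c (defect u)"
  by (rule ext) (simp add: defect_def seq_scale_def algebra_simps)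

lemma defect_null:
  assumes "u \<in> null_seqs"
  shows "defect u \<in> null_seqs"
proof -
  have "(\<lambda>m. of_real (w (m mod n)) * u (slot m k)) \<in> null_seqs"
    using w_le n_pos
    by (intro null_seqs_dominated[OF null_seqs_slot[OF assms, of k], of _ weight_bound])
      (simp add: norm_mult mult_right_mono)
  from null_seqs_diff[OF assms this] show ?thesis
    by (simp add: defect_def[abs_def] fun_diff_def)
qed

lemma null_seqs_subset_ambient: "null_seqs \<subseteq> ambient"
  unfolding ambient_def using defect_null null_seqs_Bseq by blast

lemma ambient_Bseq: "u \<in> ambient \<Longrightarrow> Bseq u" by (simp add: ambient_def)

lemma subspace_ambient: "seqs.subspace (ambient :: (nat \<Rightarrow> 'k::{real_normed_field, banach}) set)"
  unfolding seqs.subspace_def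
proof (intro conjI ballI allI)
  show "0 \<in> ambient" by (rule subsetD[OF null_seqs_subset_ambient null_seqs_zero])
  show "u + v \<in> ambient" if "u \<in> ambient" "v \<in> ambient" for u v :: "nat \<Rightarrow> 'k"
    using that by (simp add: ambient_def Bseq_plus defect_add null_seqs_add)
  show "seq_scale c u \<in> ambient" if "u \<in> ambient" for c and u :: "nat \<Rightarrow> 'k"
    using that by (simp add: ambient_def Bseq_seq_scale defect_scale null_seqs_scale)
qed

lemma ambient_uniform_limit:
  fixes u :: "nat \<Rightarrow> 'k::{real_normed_field, banach}"
  assumes approx: "\<And>\<epsilon>. 0 < \<epsilon> \<Longrightarrow> \<exists>v\<in>ambient. \<forall>m. norm (u m - v m) \<le> \<epsilon>"
  shows "u \<in> ambient"
proof -
  obtain v where v: "v \<in> ambient" "\<And>m. norm (u m - v m) \<le> 1" using approx[of 1] by auto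
  have "Bseq (u - v)" using v(2) by (intro BseqI'[of _ 1]) simp
  then have "Bseq u" using Bseq_plus[of "u - v" v] v(1) by (simp add: ambient_Bseq)
  moreover have "defect u \<in> null_seqs"
  proof (rule null_seqs_uniform_limit)
    fix \<epsilon> :: real assume \<epsilon>: "0 < \<epsilon>"
    have "0 < 1 + weight_bound" using weight_bound_nonneg by simp
    then obtain v where v: "v \<in> ambient" "\<And>m. norm (u m - v m) \<le> \<epsilon> / (1 + weight_bound)"
      using approx[of "\<epsilon> / (1 + weight_bound)"] \<epsilon> by auto
    have "norm (defect u m - defect v m) \<le> \<epsilon>" for m
      using norm_defect_le[of "u - v" "\<epsilon> / (1 + weight_bound)" m] v(2) \<open>0 < 1 + weight_bound\<close> by (simp add: defect_diff)
    then show "\<exists>v\<in>null_seqs. \<forall>m. norm (defect u m - v m) \<le> \<epsilon>"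
      using v(1) by (auto simp: ambient_def)
  qed
  ultimately show ?thesis by (simp add: ambient_def)
qed

sublocale banach_space_on seq_scale "ambient :: (nat \<Rightarrow> 'k::{real_normed_field, banach}) set" sup_norm
  by (rule banach_space_on_sup_norm[OF subspace_ambient ambient_Bseq ambient_uniform_limit])

section \<open>The subspaces and the projections onto them\<close>

lemma proj_add: "proj i (u + v) = proj i u + proj i v"
  by (rule ext) (simp add: proj_def algebra_simps sum.distrib)

lemma proj_diff: "proj i (u - v) = proj i u - proj i v"
  by (rule ext) (simp add: proj_def algebra_simps sum_subtractf)

lemma proj_scale: "proj i (seq_scale c u) = seq_scale c (proj i u)"
  by (rule ext) (simp add: proj_def seq_scale_def algebra_simps sum_distrib_left)

text \<open>Since \<open>E w = w\<close>, the part \<open>w \<otimes> z\<close> of \<open>u\<close> does not contribute. Hence the projections map the ambient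
  space into the null sequences, although its elements need not be null.\<close>

lemma proj_defect:
  assumes i: "i < n"
  shows "proj i (defect u) = proj i u"
proof
  fix m
  have "(\<Sum>j<n. of_real (e i j) * defect u (slot m j)) =
      (\<Sum>j<n. of_real (e i j) * u (slot m j) - of_real (e i j * w j) * u (slot m k))"
    using slot_mod slot_slot by (intro sum.cong) (auto simp: defect_def algebra_simps)
  also have "\<dots> = (\<Sum>j<n. of_real (e i j) * u (slot m j)) - of_real (\<Sum>j<n. e i j * w j) * u (slot m k)"
    by (simp add: sum_subtractf sum_distrib_right)
  finally show "proj i (defect u) m = proj i u m"
    unfolding proj_def eigen[OF i] by (auto simp: defect_def)
qed

lemma proj_null:
  assumes "u \<in> null_seqs"
  shows "proj i u \<in> component i"
proof -
  let ?v = "\<lambda>m. u m - (\<Sum>j<n. of_real (e i j) * u (slot m j))"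
  have "(\<Sum>j<n. seq_scale (of_real (e i j)) (\<lambda>m. u (slot m j))) \<in> null_seqs"
    using assms by (intro null_seqs_sum null_seqs_scale null_seqs_slot)
  moreover have "(\<Sum>j<n. seq_scale (of_real (e i j)) (\<lambda>m. u (slot m j))) =
      (\<lambda>m. \<Sum>j<n. of_real (e i j) * u (slot m j))"
    by (intro ext) (simp add: sum_fun_apply seq_scale_def)
  ultimately have "?v \<in> null_seqs" using null_seqs_diff[OF assms] by (simp add: fun_diff_def)
  then have "proj i u \<in> null_seqs"
    by (rule null_seqs_dominated[of _ _ 1]) (simp add: proj_def)
  then show ?thesis by (simp add: component_def proj_def)
qed

lemma proj_in_component: "i < n \<Longrightarrow> u \<in> ambient \<Longrightarrow> proj i u \<in> component i"
  using proj_null[of "defect u" i] proj_defect[of i u] by (simp add: ambient_def)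

lemma component_subset_ambient: "component i \<subseteq> ambient"
  using null_seqs_subset_ambient by (auto simp: component_def)

lemma proj_component:
  assumes u: "u \<in> component j" and ij: "i < n" "j < n"
  shows "proj i u m = (if m mod n = i then (if i = j then u m else 0) - of_real (e i j) * u (slot m j) else 0)"
proof -
  have "(\<Sum>l<n. of_real (e i l) * u (slot m l)) = (\<Sum>l<n. if l = j then of_real (e i j) * u (slot m j) else 0)"
    using u slot_mod by (intro sum.cong) (auto simp: component_def)
  also have "\<dots> = of_real (e i j) * u (slot m j)" using ij by simp
  finally show ?thesis using u by (auto simp: proj_def component_def)
qed

lemma proj_fixes_component: "i < n \<Longrightarrow> u \<in> component i \<Longrightarrow> proj i u = u"
  by (auto simp: proj_component e_diag fun_eq_iff) (auto simp: component_def)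

lemma sup_norm_proj_le:
  assumes i: "i < n" and u: "u \<in> ambient"
  shows "sup_norm (proj i u) \<le> (1 + (\<Sum>j<n. \<bar>e i j\<bar>)) * sup_norm u"
proof (rule sup_norm_le)
  fix m
  note le = norm_le_sup_norm[OF ambient_Bseq[OF u]]
  have "norm (proj i u m) \<le> norm (u m) + norm (\<Sum>j<n. of_real (e i j) * u (slot m j))"
    using norm_triangle_ineq4[of "u m"] by (auto simp: proj_def)
  also have "\<dots> \<le> sup_norm u + (\<Sum>j<n. \<bar>e i j\<bar> * sup_norm u)"
    using le by (intro add_mono sum_norm_le) (auto simp: norm_mult mult_left_mono)
  finally show "norm (proj i u m) \<le> (1 + (\<Sum>j<n. \<bar>e i j\<bar>)) * sup_norm u"
    by (simp add: sum_distrib_right distrib_right)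
qed

lemma continuous_projection_proj:
  assumes i: "i < n"
  shows "continuous_projection_onto (proj i) (component i)"
  unfolding continuous_projection_onto_def
proof (intro conjI ballI allI)
  have "proj i ` ambient \<subseteq> ambient"
    using proj_in_component[OF i] component_subset_ambient by blast
  then show "continuous_map mtopology mtopology (proj i)"
    by (rule continuous_if_bounded[OF _ proj_diff sup_norm_proj_le[OF i]])
  show "proj i (proj i u) = proj i u" if "u \<in> ambient" for u
    using proj_fixes_component[OF i proj_in_component[OF i that]] .
  show "proj i ` ambient = component i"
    using proj_in_component[OF i] proj_fixes_component[OF i] component_subset_ambient[of i] by force
qed (simp_all add: proj_add proj_scale)

lemma sup_norm_proj_component:
  assumes ij: "i < n" "j < n" "i \<noteq> j" and u: "u \<in> component j"
  shows "sup_norm (proj i u) = e i j * sup_norm u"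
proof (rule antisym)
  have eij: "0 \<le> e i j" using e_nonneg ij by simp
  have u_ambient: "u \<in> ambient" using u component_subset_ambient by blast
  note B = ambient_Bseq[OF u_ambient]
  show "sup_norm (proj i u) \<le> e i j * sup_norm u"
  proof (rule sup_norm_le)
    fix m
    show "norm (proj i u m) \<le> e i j * sup_norm u"
      using ij eij norm_le_sup_norm[OF B] sup_norm_nonneg[OF B]
      by (auto simp: proj_component[OF u ij(1,2)] norm_mult mult_left_mono)
  qed
  show "e i j * sup_norm u \<le> sup_norm (proj i u)"
  proof (cases "e i j = 0")
    case False
    have PB: "Bseq (proj i u)"
      using ambient_Bseq component_subset_ambient proj_in_component[OF ij(1) u_ambient] by blast
    have "norm (u m) \<le> sup_norm (proj i u) / e i j" for m
    proof (cases "m mod n = j")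
      case True
      \<comment> \<open>The value at \<open>m\<close> of \<open>u\<close>, supported in component \<open>j\<close>, reappears in component \<open>i\<close> of the image.\<close>
      have "e i j * norm (u m) = norm (proj i u (slot m i))"
        using ij eij slot_self[of m] True
        by (simp add: proj_component[OF u ij(1,2)] slot_mod slot_slot norm_mult)
      also have "\<dots> \<le> sup_norm (proj i u)" by (rule norm_le_sup_norm[OF PB])
      finally show ?thesis using eij False by (simp add: field_simps)
    next
      case m: False
      then show ?thesis using u eij sup_norm_nonneg[OF PB] by (auto simp: component_def)
    qed
    then have "sup_norm u \<le> sup_norm (proj i u) / e i j" by (rule sup_norm_le)
    then show ?thesis using eij False by (simp add: field_simps)
  next
    case True
    have "Bseq (proj i u)"
      using ambient_Bseq component_subset_ambient proj_in_component[OF ij(1) u_ambient] by blast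
    with True show ?thesis by (simp add: sup_norm_nonneg)
  qed
qed

lemma subspace_sum_component: "subspace_sum n component = (null_seqs :: (nat \<Rightarrow> 'k::{real_normed_field, banach}) set)"
proof
  show "subspace_sum n component \<subseteq> null_seqs"
    by (auto simp: subspace_sum_def component_def intro!: null_seqs_sum)
  show "(null_seqs :: (nat \<Rightarrow> 'k) set) \<subseteq> subspace_sum n component"
  proof
    fix u :: "nat \<Rightarrow> 'k" assume u: "u \<in> null_seqs"
    let ?x = "\<lambda>i m. if m mod n = i then u m else 0"
    have "u = (\<Sum>i<n. ?x i)" using n_pos by (auto simp: fun_eq_iff sum_fun_apply)
    moreover have "?x i \<in> component i" for i
      using null_seqs_dominated[OF u, of "?x i" 1] by (simp add: component_def)
    ultimately show "u \<in> subspace_sum n component" unfolding subspace_sum_def by blast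
  qed
qed

lemma subspaces_independent_component: "subspaces_independent n (component :: nat \<Rightarrow> (nat \<Rightarrow> 'k::{real_normed_field, banach}) set)"
  unfolding subspaces_independent_def
proof (intro allI impI)
  fix x :: "nat \<Rightarrow> nat \<Rightarrow> 'k" and i
  assume x: "(\<forall>i<n. x i \<in> component i) \<and> (\<Sum>i<n. x i) = 0" and i: "i < n"
  have "x i m = 0" for m
  proof (cases "m mod n = i")
    case True
    have "0 = (\<Sum>l<n. x l m)" using x by (metis sum_fun_apply zero_fun_apply)
    also have "\<dots> = (\<Sum>l<n. if l = i then x i m else 0)"
      using x True by (intro sum.cong) (auto simp: component_def)
    finally show ?thesis using i by simp
  qed (use x i in \<open>auto simp: component_def\<close>)
  then show "x i = 0" by (simp add: fun_eq_iff)
qed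

lemma closedin_null_seqs: "closedin mtopology (null_seqs :: (nat \<Rightarrow> 'k::{real_normed_field, banach}) set)"
  unfolding closedin_metric
proof (intro conjI allI impI null_seqs_subset_ambient)
  fix u :: "nat \<Rightarrow> 'k" assume u: "u \<in> ambient - null_seqs"
  then obtain \<epsilon> where \<epsilon>: "0 < \<epsilon>" "\<And>v. v \<in> null_seqs \<Longrightarrow> \<exists>m. \<epsilon> < norm (u m - v m)"
    using null_seqs_uniform_limit[of u] by (meson DiffD2 not_le)
  have "\<not> norm_dist ambient sup_norm u v < \<epsilon>" if v: "v \<in> null_seqs" for v
  proof -
    obtain m where m: "\<epsilon> < norm (u m - v m)" using \<epsilon>(2)[OF v] by blast
    have vs: "v \<in> ambient" using v null_seqs_subset_ambient by blast
    then have "u - v \<in> ambient" using u carrier_diff by blast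
    from norm_le_sup_norm[OF ambient_Bseq[OF this], of m] m show ?thesis
      using u vs by (simp add: norm_dist_def)
  qed
  then show "\<exists>r>0. disjnt null_seqs (mball u r)"
    using \<epsilon>(1) by (intro exI[of _ \<epsilon>]) (auto simp: disjnt_def)
qed

section \<open>The sum of the subspaces is not complemented\<close>

lemma norm_embed_le: "norm (embed z m) \<le> weight_bound * norm (z (m div n))"
  using w_le n_pos by (simp add: embed_def norm_mult mult_right_mono)

lemma defect_embed: "defect (embed z) = 0"
  using slot_mod[OF k] slot_div[OF k] by (intro ext) (simp add: defect_def embed_def w_k)

lemma norm_embed_le_sup_norm:
  assumes "Bseq z"
  shows "norm (embed z m) \<le> weight_bound * sup_norm z"
  using norm_embed_le[of z m] mult_left_mono[OF norm_le_sup_norm[OF assms, of "m div n"] weight_bound_nonneg]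
  by linarith

lemma embed_in_ambient:
  assumes "Bseq z"
  shows "embed z \<in> ambient"
proof -
  have "Bseq (embed z)" using norm_embed_le_sup_norm[OF assms] by (rule BseqI')
  then show ?thesis by (simp add: ambient_def defect_embed null_seqs_zero)
qed

lemma embed_null:
  assumes "z \<in> null_seqs"
  shows "embed z \<in> null_seqs"
proof -
  have "filterlim (\<lambda>m. m div n) at_top sequentially"
    using n_pos by (rule filterlim_at_top_div_const_nat)
  from filterlim_compose[OF assms[unfolded null_seqs_def mem_Collect_eq] this]
  have "(\<lambda>m. z (m div n)) \<in> null_seqs" by (simp add: null_seqs_def)
  then show ?thesis using norm_embed_le by (rule null_seqs_dominated)
qed

text \<open>A projection \<open>Q\<close> of the ambient space onto \<open>c\<^sub>0\<close> would yield the projection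
  \<open>z \<mapsto> (component k of Q (w \<otimes> z))\<close> of \<open>\<ell>\<^sup>\<infinity>\<close> onto \<open>c\<^sub>0\<close>: for null \<open>z\<close> the sequence \<open>w \<otimes> z\<close> is null, hence
  fixed by \<open>Q\<close>, and its component \<open>k\<close> is \<open>z\<close> because \<open>w k = 1\<close>.\<close>

lemma null_seqs_not_complemented: "\<not> complemented (null_seqs :: (nat \<Rightarrow> 'k::{real_normed_field, banach}) set)"
proof
  assume "complemented (null_seqs :: (nat \<Rightarrow> 'k) set)"
  then obtain Q :: "(nat \<Rightarrow> 'k) \<Rightarrow> nat \<Rightarrow> 'k" where Q: "continuous_projection_onto Q null_seqs"
    using projection_if_complemented by blast
  then have cont: "continuous_map mtopology mtopology Q"
    and add: "\<And>u v. u \<in> ambient \<Longrightarrow> v \<in> ambient \<Longrightarrow> Q (u + v) = Q u + Q v"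
    and sc: "\<And>c u. u \<in> ambient \<Longrightarrow> Q (seq_scale c u) = seq_scale c (Q u)"
    and idem: "\<And>u. u \<in> ambient \<Longrightarrow> Q (Q u) = Q u" and img: "Q ` ambient = null_seqs"
    unfolding continuous_projection_onto_def by auto
  obtain C where C: "\<And>u. u \<in> ambient \<Longrightarrow> sup_norm (Q u) \<le> C * sup_norm u"
    using bounded_if_continuous[OF cont add sc] by blast
  define R where "R z m = Q (embed z) (m * n + k)" for z m
  have null: "Q (embed z) \<in> null_seqs" if "Bseq z" for z
    using img embed_in_ambient[OF that] by blast
  have embed_add: "embed (u + v) = embed u + embed v" for u v :: "nat \<Rightarrow> 'k"
    by (rule ext) (simp add: embed_def algebra_simps)
  have embed_scale: "embed (seq_scale c u) = seq_scale c (embed u)" for c and u :: "nat \<Rightarrow> 'k"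
    by (rule ext) (simp add: embed_def seq_scale_def algebra_simps)
  show False
  proof (rule no_bounded_projection_onto_null_seqs[of R "\<bar>C\<bar> * weight_bound"])
    fix z :: "nat \<Rightarrow> 'k" assume z: "Bseq z"
    have "sup_norm (R z) \<le> sup_norm (Q (embed z))"
      using norm_le_sup_norm[OF null_seqs_Bseq[OF null[OF z]]] by (intro sup_norm_le) (simp add: R_def)
    also have "\<dots> \<le> \<bar>C\<bar> * sup_norm (embed z)"
      using C[OF embed_in_ambient[OF z]] sup_norm_nonneg[OF ambient_Bseq[OF embed_in_ambient[OF z]]]
      by (meson abs_ge_self mult_right_mono order_trans)
    also have "\<dots> \<le> \<bar>C\<bar> * (weight_bound * sup_norm z)"
      using sup_norm_le[of "embed z", OF norm_embed_le_sup_norm[OF z]] by (intro mult_left_mono) auto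
    finally show "sup_norm (R z) \<le> \<bar>C\<bar> * weight_bound * sup_norm z" by simp
    have "strict_mono (\<lambda>m. m * n + k)" using n_pos by (simp add: strict_mono_def)
    then show "R z \<in> null_seqs"
      using LIMSEQ_subseq_LIMSEQ[of "Q (embed z)" 0 "\<lambda>m. m * n + k"] null[OF z]
      by (simp add: null_seqs_def R_def[abs_def] comp_def)
  next
    fix u :: "nat \<Rightarrow> 'k" assume u: "u \<in> null_seqs"
    have "Q (embed u) = embed u"
      using embed_null[OF u] idem img by (metis imageE)
    then show "R u = u" using k by (auto simp: R_def embed_def w_k)
  qed (auto simp: R_def fun_eq_iff embed_add embed_scale add sc embed_in_ambient seq_scale_apply)
qed

end

section \<open>Existence of the subspaces\<close>

theorem theorem2p3:
  fixes E :: "real mat" and n :: nat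
  assumes "n \<ge> 1"
    and "E \<in> carrier_mat n n"
    and "\<And>i. i < n \<Longrightarrow> E $$ (i, i) = 0"
    and "\<And>i j. i < n \<Longrightarrow> j < n \<Longrightarrow> i \<noteq> j \<Longrightarrow> E $$ (i, j) \<ge> 0"
    and "spectral_radius (map_mat complex_of_real E) = 1"
  shows "\<exists>(X :: (nat \<Rightarrow> 'k::{real_normed_field, banach}) set) nrm Xs P.
    banach_space_on seq_scale X nrm \<and>
    (\<forall>i<n. banach_space_on.complemented seq_scale X nrm (Xs i)) \<and>
    (\<forall>i<n. banach_space_on.continuous_projection_onto seq_scale X nrm (P i) (Xs i)) \<and>
    (\<forall>i<n. \<forall>j<n. i \<noteq> j \<longrightarrow> (\<forall>x\<in>Xs j. nrm (P i x) = E $$ (i, j) * nrm x)) \<and>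
    subspaces_independent n Xs \<and>
    closedin (Metric_space.mtopology X (norm_dist X nrm)) (subspace_sum n Xs) \<and>
    \<not> banach_space_on.complemented seq_scale X nrm (subspace_sum n Xs)"
proof -
  have E_nonneg: "0 \<le> E $$ (i, j)" if "i < n" "j < n" for i j
    using assms(3,4) that by (cases "i = j") auto
  obtain w k where w: "\<And>i. i < n \<Longrightarrow> (\<Sum>j<n. E $$ (i, j) * w j) = w i" and k: "k < n" "w k = 1"
    using real_eigenvector_normalized[OF _ assms(2) E_nonneg assms(5)] assms(1) by auto
  interpret C: eigenvector_construction n k "\<lambda>i j. E $$ (i, j)" w
    using w k assms(3,4) by unfold_locales auto
  show ?thesis
  proof (intro exI conjI allI impI ballI)
    show "banach_space_on seq_scale (C.ambient :: (nat \<Rightarrow> 'k) set) sup_norm"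
      by (rule C.banach_space_on_axioms)
    show "C.continuous_projection_onto (C.proj i) (C.component i :: (nat \<Rightarrow> 'k) set)" if "i < n" for i
      using that by (rule C.continuous_projection_proj)
    then show "C.complemented (C.component i :: (nat \<Rightarrow> 'k) set)" if "i < n" for i
      using that C.complemented_if_projection by blast
    show "sup_norm (C.proj i x) = E $$ (i, j) * sup_norm x"
      if "i < n" "j < n" "i \<noteq> j" "x \<in> C.component j" for i j and x :: "nat \<Rightarrow> 'k"
      using that by (rule C.sup_norm_proj_component)
    show "subspaces_independent n (C.component :: nat \<Rightarrow> (nat \<Rightarrow> 'k) set)"
      by (rule C.subspaces_independent_component)
    show "closedin C.mtopology (subspace_sum n (C.component :: nat \<Rightarrow> (nat \<Rightarrow> 'k) set))"
      unfolding C.subspace_sum_component by (rule C.closedin_null_seqs)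
    show "\<not> C.complemented (subspace_sum n (C.component :: nat \<Rightarrow> (nat \<Rightarrow> 'k) set))"
      unfolding C.subspace_sum_component by (rule C.null_seqs_not_complemented)
  qed
qed

end
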